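(* There exist two non-isomorphic plane graphs $G_1$ and $G_2$, each with a simple closed boundary, with every internal face being a triangle or a quadrangle, and with every internal vertex $v$ satisfying $2t(v)+3q(v)\geq 12$, which have identical boundary distances: there is a bijection $\varphi$ from the set of boundary vertices of $G_1$ to the set of boundary vertices of $G_2$ such that $d_{G_1}(u,v)=d_{G_2}(\varphi(u),\varphi(v))$ for all boundary vertices $u,v$ of $G_1$.
   Context: Graphs are finite and simple. A plane graph has a simple closed boundary if its outer face is bounded by a (simple) cycle, the boundary; internal faces are all faces other than the outer face. Vertices on the boundary cycle are boundary vertices and all other vertices are internal. A triangle (quadrangle) is a face bounded by a $3$-cycle ($4$-cycle). For an internal vertex $v$, $t(v)$ and $q(v)$ denote the number of triangular faces and quadrangular faces containing $v$, respectively. $d_G$ denotes graph distance in $G$. *)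

theory Defs
  imports "HOL-Analysis.Analysis" "Graph_Theory.Graph_Theory"
begin

text \<open>
  A finite simple graph is a \<^locale>\<open>pair_graph\<close>: a finite, loop-free, symmetric digraph whose arcs
  are ordered pairs of vertices. An undirected edge is the two-element set of its ends.
\<close>

definition uedges :: "'a pair_pre_digraph \<Rightarrow> 'a set set" where
  "uedges G = {{u, v} | u v. (u, v) \<in> parcs G}"

definition graph_dist :: "'a pair_pre_digraph \<Rightarrow> 'a \<Rightarrow> 'a \<Rightarrow> ereal" where
  "graph_dist G = wf_digraph.\<mu> (with_proj G) (\<lambda>_. 1)"

text \<open>
  A plane graph has points of the plane as vertices, and each edge \<open>e\<close> is drawn as the arc \<open>\<gamma> e\<close>
  joining its ends, so that the interior of an edge contains no vertex and no point of another edge.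
\<close>

definition plane_graph :: "complex pair_pre_digraph \<Rightarrow> (complex set \<Rightarrow> real \<Rightarrow> complex) \<Rightarrow> bool" where
  "plane_graph G \<gamma> \<longleftrightarrow>
     pair_graph G \<and>
     (\<forall>e\<in>uedges G.
        arc (\<gamma> e) \<and> {pathstart (\<gamma> e), pathfinish (\<gamma> e)} = e \<and>
        (path_image (\<gamma> e) - e) \<inter> pverts G = {} \<and>
        (\<forall>f\<in>uedges G. f \<noteq> e \<longrightarrow> (path_image (\<gamma> e) - e) \<inter> path_image (\<gamma> f) = {}))"

definition drawing :: "complex pair_pre_digraph \<Rightarrow> (complex set \<Rightarrow> real \<Rightarrow> complex) \<Rightarrow> complex set" where
  "drawing G \<gamma> = pverts G \<union> (\<Union>e\<in>uedges G. path_image (\<gamma> e))"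

definition faces :: "complex pair_pre_digraph \<Rightarrow> (complex set \<Rightarrow> real \<Rightarrow> complex) \<Rightarrow> complex set set" where
  "faces G \<gamma> = components (- drawing G \<gamma>)"

text \<open>The drawing of a finite graph is compact, so \<^const>\<open>outside\<close> is its unique unbounded face.\<close>

definition outer_face :: "complex pair_pre_digraph \<Rightarrow> (complex set \<Rightarrow> real \<Rightarrow> complex) \<Rightarrow> complex set" where
  "outer_face G \<gamma> = outside (drawing G \<gamma>)"

definition internal_faces :: "complex pair_pre_digraph \<Rightarrow> (complex set \<Rightarrow> real \<Rightarrow> complex) \<Rightarrow> complex set set" where
  "internal_faces G \<gamma> = faces G \<gamma> - {outer_face G \<gamma>}"

text \<open>
  In a symmetric digraph \<^const>\<open>pre_digraph.cycle\<close> also admits the closed walk of length 2 along an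
  edge and back, hence the lower bound on \<open>k\<close>.
\<close>

definition bounded_by_cycle ::
  "complex pair_pre_digraph \<Rightarrow> (complex set \<Rightarrow> real \<Rightarrow> complex) \<Rightarrow> nat \<Rightarrow> complex set \<Rightarrow> bool" where
  "bounded_by_cycle G \<gamma> k F \<longleftrightarrow>
     3 \<le> k \<and>
     (\<exists>p. pre_digraph.cycle (with_proj G) p \<and> length p = k \<and>
          frontier F = (\<Union>(u, v)\<in>set p. path_image (\<gamma> {u, v})))"

definition simple_closed_boundary ::
  "complex pair_pre_digraph \<Rightarrow> (complex set \<Rightarrow> real \<Rightarrow> complex) \<Rightarrow> bool" where
  "simple_closed_boundary G \<gamma> \<longleftrightarrow> (\<exists>k. bounded_by_cycle G \<gamma> k (outer_face G \<gamma>))"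

text \<open>
  When the outer face is bounded by a cycle, the vertices on its frontier are exactly those of
  that cycle, since edge interiors contain no vertices.
\<close>

definition boundary_verts ::
  "complex pair_pre_digraph \<Rightarrow> (complex set \<Rightarrow> real \<Rightarrow> complex) \<Rightarrow> complex set" where
  "boundary_verts G \<gamma> = pverts G \<inter> frontier (outer_face G \<gamma>)"

definition internal_verts ::
  "complex pair_pre_digraph \<Rightarrow> (complex set \<Rightarrow> real \<Rightarrow> complex) \<Rightarrow> complex set" where
  "internal_verts G \<gamma> = pverts G - boundary_verts G \<gamma>"

definition triangles :: "complex pair_pre_digraph \<Rightarrow> (complex set \<Rightarrow> real \<Rightarrow> complex) \<Rightarrow> complex set set" where
  "triangles G \<gamma> = {F \<in> faces G \<gamma>. bounded_by_cycle G \<gamma> 3 F}"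

definition quadrangles :: "complex pair_pre_digraph \<Rightarrow> (complex set \<Rightarrow> real \<Rightarrow> complex) \<Rightarrow> complex set set" where
  "quadrangles G \<gamma> = {F \<in> faces G \<gamma>. bounded_by_cycle G \<gamma> 4 F}"

text \<open>Faces are open sets, so a face contains a vertex in the graph sense if its frontier does.\<close>

definition tri_count :: "complex pair_pre_digraph \<Rightarrow> (complex set \<Rightarrow> real \<Rightarrow> complex) \<Rightarrow> complex \<Rightarrow> nat" where
  "tri_count G \<gamma> v = card {F \<in> triangles G \<gamma>. v \<in> frontier F}"

definition quad_count :: "complex pair_pre_digraph \<Rightarrow> (complex set \<Rightarrow> real \<Rightarrow> complex) \<Rightarrow> complex \<Rightarrow> nat" where
  "quad_count G \<gamma> v = card {F \<in> quadrangles G \<gamma>. v \<in> frontier F}"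

end

theory Submission
  imports Defs
begin

text \<open>
  Both graphs contain a nine-cycle \<open>b0\<close>, \<dots>, \<open>b8\<close> filled in by a triangle \<open>h0\<close>, \<open>h1\<close>, \<open>h2\<close>. Each corner
  of the inner triangle is joined to three consecutive vertices of the cycle, so that three
  quadrangles sit on the sides of the inner triangle and two triangles at each of its corners. Every
  \<open>h\<close> then has three triangles and two quadrangles around it, so that \<open>2 * 3 + 3 * 2 = 12\<close>. Within this
  filling the distance of two vertices of the cycle is the minimum of \<open>3\<close> and their distance along
  the cycle. Hence rotating the filling by one step does not change any of these distances, although
  the filling itself is invariant only under rotation by three steps.

  A further triangle, with the new vertex \<open>apex\<close>, is glued to the side from \<open>b0\<close> to \<open>b1\<close>. It
  records how the filling is rotated. In the first graph that side belongs to an inner triangle, and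
  the two neighbours of \<open>apex\<close> are both neighbours of \<open>h0\<close>. In the second graph the side belongs to an
  inner quadrangle, and there no vertex has all its neighbours among those of another vertex
  (\<open>has_dominated_vertex_iso\<close>). So the graphs are not isomorphic, while the identity on the boundary
  vertices preserves distances, as the new vertex hangs on the cycle in the same way in both graphs.

  Both graphs are drawn with straight edges on the same integer points, with a convex boundary
  polygon and strictly convex faces. The topological claims reduce to signs of determinants by a
  general fact (\<open>closed_faces_cover\<close> and \<open>faces_G\<close>): convex polygons whose interiors avoid the drawing,
  and whose sides match up in pairs of opposite directions except along the boundary polygon, are
  exactly the bounded faces. The determinants, face counts, distances and neighbourhoods are then
  evaluated.
\<close>

section \<open>Orientation of point triples\<close>

text \<open>
  Twice the signed area of the triangle \<open>a\<close>, \<open>b\<close>, \<open>c\<close>: positive if \<open>c\<close> lies to the left of the line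
  from \<open>a\<close> to \<open>b\<close>, zero on the line. All incidences below are read off from its sign, because it is
  affine in the last argument.
\<close>

definition orient :: "complex \<Rightarrow> complex \<Rightarrow> complex \<Rightarrow> real" where
  "orient a b c = (Re b - Re a) * (Im c - Im a) - (Im b - Im a) * (Re c - Re a)"

lemma orient_swap: "orient b a c = - orient a b c"
  by (simp add: orient_def algebra_simps)

lemma orient_self [simp]: "orient a b a = 0" "orient a b b = 0"
  by (simp_all add: orient_def algebra_simps)

lemma orient_convex_combination:
  assumes "s + t = 1"
  shows "orient a b (s *\<^sub>R x + t *\<^sub>R y) = s * orient a b x + t * orient a b y"
proof -
  have s: "s = 1 - t" using assms by simp
  show ?thesis unfolding s by (simp add: orient_def algebra_simps)
qed

lemma continuous_on_orient [continuous_intros]: "continuous_on S (orient a b)"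
  unfolding orient_def by (intro continuous_intros)

lemma orient_closed_segment:
  assumes "z \<in> closed_segment x y"
  shows "\<exists>t. 0 \<le> t \<and> t \<le> 1 \<and> z = (1 - t) *\<^sub>R x + t *\<^sub>R y \<and>
    (\<forall>a b. orient a b z = (1 - t) * orient a b x + t * orient a b y)"
proof -
  obtain t where "0 \<le> t" "t \<le> 1" "z = (1 - t) *\<^sub>R x + t *\<^sub>R y"
    using assms by (auto simp: closed_segment_def)
  then show ?thesis by (auto intro!: exI[of _ t] orient_convex_combination)
qed

lemma orient_open_segment:
  assumes "z \<in> open_segment x y"
  shows "\<exists>t. 0 < t \<and> t < 1 \<and> z = (1 - t) *\<^sub>R x + t *\<^sub>R y \<and>
    (\<forall>a b. orient a b z = (1 - t) * orient a b x + t * orient a b y)"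
proof -
  obtain t where "0 < t" "t < 1" "z = (1 - t) *\<^sub>R x + t *\<^sub>R y"
    using assms by (auto simp: in_segment)
  then show ?thesis by (auto intro!: exI[of _ t] orient_convex_combination)
qed

lemma orient_eq_0D:
  assumes "orient a b z = 0" "a \<noteq> b"
  obtains t where "z = (1 - t) *\<^sub>R a + t *\<^sub>R b"
proof -
  define t where "t = (if Re b = Re a then (Im z - Im a) / (Im b - Im a) else (Re z - Re a) / (Re b - Re a))"
  have "Re b \<noteq> Re a \<or> Im b \<noteq> Im a" using assms(2) by (auto simp: complex_eq_iff)
  then have "z = (1 - t) *\<^sub>R a + t *\<^sub>R b"
    using assms(1) by (auto simp: complex_eq_iff t_def orient_def field_simps)
  then show ?thesis by (rule that)
qed

lemma convex_combination_eq_0D: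
  fixes p q t :: real
  assumes "(1 - t) * p + t * q = 0" "0 \<le> t" "t \<le> 1" "0 \<le> p * q"
  shows "(1 - t) * p = 0 \<and> t * q = 0"
proof -
  consider "0 \<le> p" "0 \<le> q" | "p \<le> 0" "q \<le> 0"
    using assms(4) by (auto simp: zero_le_mult_iff)
  then show ?thesis
  proof cases
    case 1
    with assms(2,3) have "0 \<le> (1 - t) * p" "0 \<le> t * q" by auto
    with assms(1) show ?thesis by linarith
  next
    case 2
    with assms(2,3) have "(1 - t) * p \<le> 0" "t * q \<le> 0" by (auto simp: mult_le_0_iff)
    with assms(1) show ?thesis by linarith
  qed
qed

section \<open>Strictly convex polygons\<close>

text \<open>
  The sides of a closed polygon, directed along the list. A side shared by two counterclockwise
  polygons occurs once in each direction.
\<close>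

definition darts :: "'a list \<Rightarrow> ('a \<times> 'a) list" where
  "darts ps = zip ps (rotate1 ps)"

lemma length_darts [simp]: "length (darts ps) = length ps"
  by (simp add: darts_def)

lemma dartsD: "(u, v) \<in> set (darts ps) \<Longrightarrow> u \<in> set ps \<and> v \<in> set ps"
  unfolding darts_def by (metis set_rotate1 set_zip_leftD set_zip_rightD)

lemma fst_darts: "fst ` set (darts ps) = set ps"
  and snd_darts: "snd ` set (darts ps) = set ps"
  unfolding darts_def by (metis length_rotate1 list.set_map map_fst_zip,
    metis length_rotate1 list.set_map map_snd_zip set_rotate1)

lemma darts_out: "u \<in> set ps \<Longrightarrow> \<exists>v. (u, v) \<in> set (darts ps)"
  and darts_in: "u \<in> set ps \<Longrightarrow> \<exists>v. (v, u) \<in> set (darts ps)"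
  using fst_darts[of ps] snd_darts[of ps] by force+

lemma darts_distinct_ends:
  assumes "distinct ps" "2 \<le> length ps" "(u, v) \<in> set (darts ps)"
  shows "u \<noteq> v"
proof -
  obtain i where i: "i < length ps" "u = ps ! i" "v = ps ! (Suc i mod length ps)"
    using assms(3) by (auto simp: darts_def in_set_zip nth_rotate1)
  have "Suc i mod length ps \<noteq> i"
    using i(1) assms(2) by (cases "Suc i = length ps") auto
  moreover have "Suc i mod length ps < length ps" using i(1) by (intro mod_less_divisor) auto
  ultimately show ?thesis using i assms(1) by (metis nth_eq_iff_index_eq)
qed

text \<open>
  Counterclockwise and strictly convex: every vertex off a side lies strictly to the left of it.
\<close>

definition convex_polygon :: "complex list \<Rightarrow> bool" where
  "convex_polygon ps \<longleftrightarrow> distinct ps \<and> 3 \<le> length ps \<and>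
     (\<forall>(u, v)\<in>set (darts ps). \<forall>w\<in>set ps - {u, v}. 0 < orient u v w)"

definition polygon_interior :: "complex list \<Rightarrow> complex set" where
  "polygon_interior ps = {z. \<forall>(u, v)\<in>set (darts ps). 0 < orient u v z}"

definition polygon_boundary :: "complex list \<Rightarrow> complex set" where
  "polygon_boundary ps = (\<Union>(u, v)\<in>set (darts ps). closed_segment u v)"

lemma open_polygon_interior: "open (polygon_interior ps)"
proof -
  have "polygon_interior ps = (\<Inter>d\<in>set (darts ps). {z. 0 < orient (fst d) (snd d) z})"
    by (force simp: polygon_interior_def)
  then show ?thesis
    by (auto intro!: open_INT open_Collect_less continuous_intros)
qed

lemma convex_polygon_interior: "convex (polygon_interior ps)"
proof (rule convexI)
  fix x y :: complex and s t :: real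
  assume *: "x \<in> polygon_interior ps" "y \<in> polygon_interior ps" "0 \<le> s" "0 \<le> t" "s + t = 1"
  show "s *\<^sub>R x + t *\<^sub>R y \<in> polygon_interior ps"
  proof -
    have "0 < s * orient u v x + t * orient u v y" if "(u, v) \<in> set (darts ps)" for u v
    proof -
      have "0 < orient u v x" "0 < orient u v y" using * that by (auto simp: polygon_interior_def)
      moreover have "0 < s \<or> 0 < t" using *(3-5) by linarith
      ultimately show ?thesis using *(3,4)
        by (metis add_cancel_right_left add_nonneg_pos add_pos_nonneg less_eq_real_def mult_nonneg_nonneg
            mult_pos_pos)
    qed
    then show ?thesis using *(5) by (auto simp: polygon_interior_def orient_convex_combination)
  qed
qed

lemma orient_scaleR_sum:
  assumes "finite A" "A \<noteq> {}"
  shows "orient u v ((\<Sum>a\<in>A. a) /\<^sub>R real (card A)) = (\<Sum>a\<in>A. orient u v a) / real (card A)"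
proof -
  define p q r where "p = Re v - Re u" and "q = Im v - Im u"
    and "r = Im v * Re u - Im u * Re v"
  have affine: "orient u v z = p * Im z - q * Re z + r" for z
    by (simp add: orient_def p_def q_def r_def algebra_simps)
  have "(\<Sum>a\<in>A. orient u v a) = p * (\<Sum>a\<in>A. Im a) - q * (\<Sum>a\<in>A. Re a) + real (card A) * r"
    by (simp add: affine sum.distrib sum_subtractf sum_distrib_left)
  moreover have "real (card A) \<noteq> 0" using assms by simp
  ultimately show ?thesis by (simp add: affine field_simps)
qed

lemma centroid_orient_pos:
  assumes "finite A" "w \<in> A" "\<And>a. a \<in> A \<Longrightarrow> 0 \<le> orient u v a" "0 < orient u v w"
  shows "0 < orient u v ((\<Sum>a\<in>A. a) /\<^sub>R real (card A))"
proof -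
  have "0 < (\<Sum>a\<in>A. orient u v a)" using assms by (intro sum_pos2[of _ w]) auto
  moreover have "0 < card A" using assms card_gt_0_iff by blast
  ultimately show ?thesis using assms by (subst orient_scaleR_sum) auto
qed

context
  fixes ps assumes convex: "convex_polygon ps"
begin

lemma polygon_distinct: "distinct ps" and polygon_length: "3 \<le> length ps"
  using convex by (auto simp: convex_polygon_def)

lemma polygon_pos: "(u, v) \<in> set (darts ps) \<Longrightarrow> w \<in> set ps \<Longrightarrow> w \<noteq> u \<Longrightarrow> w \<noteq> v \<Longrightarrow> 0 < orient u v w"
  using convex by (auto simp: convex_polygon_def)

lemma polygon_nonneg: "(u, v) \<in> set (darts ps) \<Longrightarrow> w \<in> set ps \<Longrightarrow> 0 \<le> orient u v w"
  using polygon_pos[of u v w] by (cases "w = u \<or> w = v") auto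

lemma polygon_third_vertex: "\<exists>w\<in>set ps. w \<noteq> u \<and> w \<noteq> v"
proof (rule ccontr)
  assume "\<not> ?thesis"
  then have "set ps \<subseteq> {u, v}" by blast
  then have "card (set ps) \<le> card {u, v}" by (intro card_mono) auto
  also have "\<dots> \<le> 2" by (simp add: card_insert_if)
  finally have "card (set ps) \<le> 2" .
  then show False using distinct_card[OF polygon_distinct] polygon_length by simp
qed

lemma polygon_dart_neq: "(u, v) \<in> set (darts ps) \<Longrightarrow> u \<noteq> v"
  using darts_distinct_ends polygon_distinct polygon_length by fastforce

text \<open>
  A third vertex would lie strictly on both sides of the line.
\<close>

lemma polygon_no_reverse_dart:
  assumes "(u, v) \<in> set (darts ps)"
  shows "(v, u) \<notin> set (darts ps)"
proof
  assume rev: "(v, u) \<in> set (darts ps)"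
  obtain w where "w \<in> set ps" "w \<noteq> u" "w \<noteq> v" using polygon_third_vertex by blast
  then show False using polygon_pos[OF assms, of w] polygon_pos[OF rev, of w] orient_swap[of v u w] by simp
qed

lemma polygon_interior_nonempty: "polygon_interior ps \<noteq> {}"
proof -
  have "(\<Sum>a\<in>set ps. a) /\<^sub>R real (card (set ps)) \<in> polygon_interior ps"
    unfolding polygon_interior_def
  proof safe
    fix u v assume uv: "(u, v) \<in> set (darts ps)"
    obtain w where "w \<in> set ps" "w \<noteq> u" "w \<noteq> v" using polygon_third_vertex by blast
    with uv show "0 < orient u v ((\<Sum>a\<in>set ps. a) /\<^sub>R real (card (set ps)))"
      by (intro centroid_orient_pos[of _ w]) (auto intro: polygon_nonneg polygon_pos)
  qed
  then show ?thesis by blast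
qed

text \<open>
  The open segment from an interior point to a point of the closed polygon stays in the interior.
\<close>

lemma closure_polygon_interior:
  "closure (polygon_interior ps) = {z. \<forall>(u, v)\<in>set (darts ps). 0 \<le> orient u v z}" (is "_ = ?C")
proof
  have "?C = (\<Inter>d\<in>set (darts ps). {z. 0 \<le> orient (fst d) (snd d) z})" by force
  then have "closed ?C" by (auto intro!: closed_INT closed_Collect_le continuous_intros)
  moreover have "polygon_interior ps \<subseteq> ?C" by (force simp: polygon_interior_def)
  ultimately show "closure (polygon_interior ps) \<subseteq> ?C" by (rule closure_minimal[rotated])
  show "?C \<subseteq> closure (polygon_interior ps)"
  proof
    fix z assume z: "z \<in> ?C"
    obtain c where c: "c \<in> polygon_interior ps" using polygon_interior_nonempty by blast
    have "open_segment c z \<subseteq> polygon_interior ps"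
    proof
      fix x assume "x \<in> open_segment c z"
      from orient_open_segment[OF this] obtain t where
        "0 < t" "t < 1" "\<forall>a b. orient a b x = (1 - t) * orient a b c + t * orient a b z" by blast
      then show "x \<in> polygon_interior ps"
        using c z unfolding polygon_interior_def by (auto intro!: add_pos_nonneg)
    qed
    then have "closure (open_segment c z) \<subseteq> closure (polygon_interior ps)" by (rule closure_mono)
    then show "z \<in> closure (polygon_interior ps)"
      using c closure_subset by (cases "c = z") auto
  qed
qed

lemma frontier_polygon_interior: "frontier (polygon_interior ps) = polygon_boundary ps"
proof -
  have "frontier (polygon_interior ps)
      = {z. \<forall>(u, v)\<in>set (darts ps). 0 \<le> orient u v z} \<inter> {z. \<exists>(u, v)\<in>set (darts ps). orient u v z = 0}"
  proof (rule set_eqI)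
    fix z
    have "(\<forall>d\<in>D. 0 < f d) \<longleftrightarrow> \<not> (\<exists>d\<in>D. f d = 0)" if "\<forall>d\<in>D. 0 \<le> f d"
      for D and f :: "complex \<times> complex \<Rightarrow> real"
      using that by (metis less_le)
    from this[of "set (darts ps)" "\<lambda>(u, v). orient u v z"]
    show "z \<in> frontier (polygon_interior ps) \<longleftrightarrow>
        z \<in> {z. \<forall>(u, v)\<in>set (darts ps). 0 \<le> orient u v z} \<inter> {z. \<exists>(u, v)\<in>set (darts ps). orient u v z = 0}"
      unfolding frontier_def interior_open[OF open_polygon_interior] closure_polygon_interior
      by (simp add: polygon_interior_def case_prod_beta) blast
  qed
  also have "\<dots> = polygon_boundary ps"
  proof safe
    fix z u v
    assume nonneg: "\<forall>(u, v)\<in>set (darts ps). 0 \<le> orient u v z"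
      and uv: "(u, v) \<in> set (darts ps)" and 0: "orient u v z = 0"
    obtain t where t: "z = (1 - t) *\<^sub>R u + t *\<^sub>R v"
      using orient_eq_0D[OF 0 polygon_dart_neq[OF uv]] by blast
    have z: "orient a b z = (1 - t) * orient a b u + t * orient a b v" for a b
      unfolding t by (rule orient_convex_combination) simp
    \<comment> \<open>The neighbouring sides of the polygon cut the line through \<open>u\<close> and \<open>v\<close> down to the segment.\<close>
    obtain w where w: "(v, w) \<in> set (darts ps)" using darts_out[of v ps] dartsD[OF uv] by blast
    have "w \<noteq> u" using polygon_no_reverse_dart[OF uv] w by blast
    then have "0 < orient v w u"
      using polygon_pos[OF w, of u] dartsD[OF uv] polygon_dart_neq[OF uv] by blast
    moreover have "0 \<le> (1 - t) * orient v w u" using nonneg w z[of v w] by fastforce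
    ultimately have "t \<le> 1" by (simp add: zero_le_mult_iff)
    obtain x where x: "(x, u) \<in> set (darts ps)" using darts_in[of u ps] dartsD[OF uv] by blast
    have "x \<noteq> v" using polygon_no_reverse_dart[OF uv] x by blast
    then have "0 < orient x u v"
      using polygon_pos[OF x, of v] dartsD[OF uv] polygon_dart_neq[OF uv] by blast
    moreover have "0 \<le> t * orient x u v" using nonneg x z[of x u] by fastforce
    ultimately have "0 \<le> t" by (simp add: zero_le_mult_iff)
    with \<open>t \<le> 1\<close> t have "z \<in> closed_segment u v" by (auto simp: closed_segment_def)
    with uv show "z \<in> polygon_boundary ps" by (auto simp: polygon_boundary_def)
  next
    fix z assume "z \<in> polygon_boundary ps"
    then obtain u v where uv: "(u, v) \<in> set (darts ps)" "z \<in> closed_segment u v"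
      by (auto simp: polygon_boundary_def)
    obtain t where t: "0 \<le> t" "t \<le> 1" "\<forall>a b. orient a b z = (1 - t) * orient a b u + t * orient a b v"
      using orient_closed_segment[OF uv(2)] by blast
    show "\<exists>(u, v)\<in>set (darts ps). orient u v z = 0"
      using uv(1) t(3) by (intro bexI[of _ "(u, v)"]) auto
    fix a b assume "(a, b) \<in> set (darts ps)"
    then show "0 \<le> orient a b z" using t dartsD[OF uv(1)] by (simp add: polygon_nonneg)
  qed
  finally show ?thesis .
qed

text \<open>
  The boundary lies in a ball, and the complement of that ball is connected. If the interior met this
  complement, it would contain all of it; but some far points lie on the wrong side of a given side.
\<close>

lemma bounded_polygon_interior: "bounded (polygon_interior ps)"
proof -
  have "compact (polygon_boundary ps)"
    unfolding polygon_boundary_def by (intro compact_UN) auto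
  then obtain r where r: "polygon_boundary ps \<subseteq> ball 0 r" "0 < r"
    using bounded_subset_ballD[of "polygon_boundary ps" 0] compact_imp_bounded by blast
  obtain u v where uv: "(u, v) \<in> set (darts ps)"
    using polygon_third_vertex[of undefined undefined] darts_out[of _ ps] by blast
  \<comment> \<open>A far point on the wrong side of the line through \<open>u\<close> and \<open>v\<close>.\<close>
  define far where "far s = u - s *\<^sub>R (\<i> * (v - u))" for s :: real
  have far: "orient u v (far s) = - s * (norm (v - u))\<^sup>2" for s
    unfolding cmod_power2 by (simp add: orient_def far_def power2_eq_square algebra_simps)
  define s where "s = (r + 1 + norm u) / norm (v - u)"
  have pos: "0 < norm (v - u)" using polygon_dart_neq[OF uv] by simp
  have "0 < s" using pos r(2) by (auto simp: s_def intro!: divide_pos_pos add_pos_nonneg)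
  then have "norm (u - far s) = s * norm (v - u)" by (simp add: far_def norm_mult)
  also have "\<dots> = r + 1 + norm u" using pos by (simp add: s_def)
  finally have "r \<le> norm (far s)" using norm_triangle_ineq4[of u "far s"] by linarith
  then have "far s \<in> - ball 0 r" by simp
  moreover have "far s \<notin> polygon_interior ps"
  proof -
    have "orient u v (far s) \<le> 0" using \<open>0 < s\<close> by (simp add: far)
    then show ?thesis using uv by (force simp: polygon_interior_def)
  qed
  ultimately have "- ball 0 r - polygon_interior ps \<noteq> {}" by blast
  moreover have "Topological_Spaces.connected (- ball 0 r :: complex set)"
    by (intro connected_complement_bounded_convex) auto
  ultimately have "- ball 0 r \<inter> polygon_interior ps = {}"
    using connected_Int_frontier[of "- ball 0 r" "polygon_interior ps"] r(1) frontier_polygon_interior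
    by auto
  then have "polygon_interior ps \<subseteq> ball 0 r" by blast
  then show ?thesis using bounded_subset bounded_ball by blast
qed

end

text \<open>
  Near an inner point of a side all the other side conditions hold strictly, so there the closed polygon
  is a half-disc. Two polygons on opposite sides of a common edge therefore cover a full neighbourhood.
\<close>

lemma half_neighbourhood:
  assumes ps: "convex_polygon ps" and uv: "(u, v) \<in> set (darts ps)" and z: "z \<in> open_segment u v"
  obtains T where "open T" "z \<in> T" "\<And>x. x \<in> T \<Longrightarrow> 0 \<le> orient u v x \<Longrightarrow> x \<in> closure (polygon_interior ps)"
proof
  let ?T = "\<Inter>d\<in>set (darts ps) - {(u, v)}. {x. 0 < orient (fst d) (snd d) x}"
  show "open ?T" by (auto intro!: open_INT open_Collect_less continuous_intros)
  obtain t where t: "0 < t" "t < 1" "\<forall>a b. orient a b z = (1 - t) * orient a b u + t * orient a b v"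
    using orient_open_segment[OF z] by blast
  have "0 < orient a b z" if ab: "(a, b) \<in> set (darts ps)" "(a, b) \<noteq> (u, v)" for a b
  proof -
    note nonneg = polygon_nonneg[OF ps ab(1)] and pos = polygon_pos[OF ps ab(1)]
    have verts: "u \<in> set ps" "v \<in> set ps" using dartsD[OF uv] by auto
    have "u \<noteq> v" using polygon_dart_neq[OF ps uv] .
    have "(a, b) \<noteq> (v, u)" using polygon_no_reverse_dart[OF ps uv] ab(1) by blast
    with ab(2) \<open>u \<noteq> v\<close> have "u \<noteq> a \<and> u \<noteq> b \<or> v \<noteq> a \<and> v \<noteq> b" by blast
    then have "0 < orient a b u \<or> 0 < orient a b v" using pos verts by blast
    moreover have "0 \<le> orient a b u" "0 \<le> orient a b v" using nonneg verts by auto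
    ultimately show ?thesis using t(1,2) unfolding t(3)[rule_format]
      by (auto intro: add_pos_nonneg add_nonneg_pos)
  qed
  then show "z \<in> ?T" by (simp add: split_paired_all)
  fix x assume x: "x \<in> ?T" and 0: "0 \<le> orient u v x"
  have "0 \<le> orient a b x" if "(a, b) \<in> set (darts ps)" for a b
  proof (cases "(a, b) = (u, v)")
    case False
    with that have "x \<in> {x. 0 < orient (fst (a, b)) (snd (a, b)) x}" by (intro INT_D[OF x]) simp
    then show ?thesis by simp
  qed (use 0 in simp)
  then show "x \<in> closure (polygon_interior ps)"
    by (auto simp: closure_polygon_interior[OF ps])
qed

section \<open>Straight-line graphs given by their faces\<close>

text \<open>
  A sign condition on the end points that keeps the open segment from \<open>a\<close> to \<open>b\<close> away from the closed
  segment from \<open>c\<close> to \<open>d\<close>. Either \<open>a\<close> and \<open>b\<close> lie weakly, but not both exactly, on one side of the line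
  through \<open>c\<close> and \<open>d\<close>, or \<open>c\<close> and \<open>d\<close> lie strictly on one side of the line through \<open>a\<close> and \<open>b\<close>. The
  first alternative also covers edges with a common end point.
\<close>

definition separated_edges :: "complex \<Rightarrow> complex \<Rightarrow> complex \<Rightarrow> complex \<Rightarrow> bool" where
  "separated_edges a b c d \<longleftrightarrow>
     0 \<le> orient c d a * orient c d b \<and> (orient c d a \<noteq> 0 \<or> orient c d b \<noteq> 0) \<or>
     0 < orient a b c * orient a b d"

lemma separated_edgesD:
  assumes "separated_edges a b c d"
  shows "open_segment a b \<inter> closed_segment c d = {}"
proof (rule ccontr)
  assume "\<not> ?thesis"
  then obtain z where z: "z \<in> open_segment a b" "z \<in> closed_segment c d" by blast
  obtain t where t: "0 < t" "t < 1" "\<forall>x y. orient x y z = (1 - t) * orient x y a + t * orient x y b"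
    using orient_open_segment[OF z(1)] by blast
  obtain s where s: "0 \<le> s" "s \<le> 1" "\<forall>x y. orient x y z = (1 - s) * orient x y c + s * orient x y d"
    using orient_closed_segment[OF z(2)] by blast
  have *: "(1 - t) * orient c d a + t * orient c d b = 0" using s(3) t(3)
    by (metis add_0 mult_zero_right orient_self)
  have **: "(1 - s) * orient a b c + s * orient a b d = 0" using s(3) t(3)
    by (metis add_0 mult_zero_right orient_self)
  show False
  proof (cases "0 < orient a b c * orient a b d")
    case True
    then show False using convex_combination_eq_0D[OF ** s(1,2)] by auto
  next
    case False
    with assms show False
      using convex_combination_eq_0D[OF *] t(1,2) by (auto simp: separated_edges_def)
  qed
qed

text \<open>
  An undirected edge has no preferred direction, so one of its two parametrisations is chosen.
\<close>

definition straight_edge :: "complex set \<Rightarrow> real \<Rightarrow> complex" where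
  "straight_edge e = (SOME p. \<exists>u v. e = {u, v} \<and> p = linepath u v)"

lemma straight_edge_cases:
  obtains a b where "{u, v} = {a, b}" "straight_edge {u, v} = linepath a b"
proof -
  have "\<exists>p a b. {u, v} = {a, b} \<and> p = linepath a b" by blast
  from someI_ex[OF this] show ?thesis unfolding straight_edge_def[symmetric] using that by blast
qed

lemma path_image_straight_edge [simp]: "path_image (straight_edge {u, v}) = closed_segment u v"
  by (rule straight_edge_cases[of u v]) (auto simp: doubleton_eq_iff closed_segment_commute)

lemma arc_straight_edge: "u \<noteq> v \<Longrightarrow> arc (straight_edge {u, v})"
  and ends_straight_edge: "{pathstart (straight_edge {u, v}), pathfinish (straight_edge {u, v})} = {u, v}"
  by (rule straight_edge_cases[of u v]; auto simp: doubleton_eq_iff arc_linepath)+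

definition face_verts :: "'a list list \<Rightarrow> 'a set" where
  "face_verts fs = \<Union> (set ` set fs)"

text \<open>
  The graph carried by a list of counterclockwise faces \<open>fs\<close> inside a counterclockwise boundary cycle
  \<open>bs\<close>. An edge between two faces gets one direction from each of them; a boundary edge gets its
  second direction from the outer face, which runs along \<open>bs\<close> backwards.
\<close>

definition face_arcs :: "'a list list \<Rightarrow> 'a list \<Rightarrow> ('a \<times> 'a) set" where
  "face_arcs fs bs = (\<Union>f\<in>set fs. set (darts f)) \<union> (set (darts bs))\<inverse>"

definition face_graph :: "'a list list \<Rightarrow> 'a list \<Rightarrow> 'a pair_pre_digraph" where
  "face_graph fs bs = \<lparr>pverts = face_verts fs, parcs = face_arcs fs bs\<rparr>"

lemma face_graph_simps [simp]:
  "pverts (face_graph fs bs) = face_verts fs" "parcs (face_graph fs bs) = face_arcs fs bs"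
  by (simp_all add: face_graph_def)

lemma cycle_darts:
  assumes "distinct ps" "ps \<noteq> []" "set ps \<subseteq> pverts G" "set (darts ps) \<subseteq> parcs G"
  shows "pre_digraph.cycle (with_proj G) (darts ps)"
proof -
  obtain x xs where ps: "ps = x # xs" using assms(2) by (cases ps) auto
  have cas: "pcas x (zip (x # xs) (xs @ [y])) y" for x y :: 'a and xs
    by (induction xs arbitrary: x) auto
  have verts: "pawalk_verts x (zip (x # xs) (xs @ [y])) = x # xs @ [y]" for x y :: 'a and xs
    by (induction xs arbitrary: x) auto
  have darts: "darts ps = zip (x # xs) (xs @ [x])" by (simp add: ps darts_def)
  show ?thesis
    unfolding pre_digraph.cycle_def pre_digraph.awalk_def cas_with_proj_eq awalk_verts_with_proj_eq
    using assms cas[of x xs x] verts[of x xs x]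
    by (intro exI[of _ x]) (auto simp: darts, auto simp: ps)
qed

section \<open>Subdivisions of a convex polygon\<close>

text \<open>
  A connected set can leave \<open>A\<close> only through the frontier of \<open>A\<close>.
\<close>

lemma component_if_frontier_subset:
  fixes A S :: "complex set"
  assumes "Topological_Spaces.connected A" "A \<noteq> {}" "A \<inter> S = {}" "frontier A \<subseteq> S"
  shows "A \<in> components (- S)"
  unfolding in_components_maximal
proof (intro conjI allI impI)
  show "A \<noteq> {}" "A \<subseteq> - S" "Topological_Spaces.connected A" using assms by auto
  fix B assume B: "B \<noteq> {} \<and> A \<subseteq> B \<and> B \<subseteq> - S \<and> Topological_Spaces.connected B"
  then have "B - A = {}"
    using connected_Int_frontier[of B A] assms(2,4) by blast
  with B show "B = A" by blast
qed

text \<open>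
  Finitely many sign conditions which make the faces \<open>fs\<close> tile the convex polygon \<open>bs\<close>. That the faces
  leave no gap is not among the assumptions: it follows from \<open>arcs_sym\<close>, which says that every side of
  a face is also a side of a face on its other side, or a side of \<open>bs\<close>.
\<close>

locale polygon_subdivision =
  fixes fs :: "complex list list" and bs :: "complex list"
  assumes faces_nonempty: "fs \<noteq> []"
    and face_convex: "f \<in> set fs \<Longrightarrow> convex_polygon f"
    and faces_distinct: "distinct (map set fs)"
    and boundary_distinct: "distinct bs" "3 \<le> length bs"
    and boundary_pos: "(u, v) \<in> set (darts bs) \<Longrightarrow> w \<in> face_verts fs - {u, v} \<Longrightarrow> 0 < orient u v w"
    and arcs_sym: "(u, v) \<in> face_arcs fs bs \<Longrightarrow> (v, u) \<in> face_arcs fs bs"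
    and arcs_separated: "(a, b) \<in> face_arcs fs bs \<Longrightarrow> (c, d) \<in> face_arcs fs bs \<Longrightarrow>
      {a, b} \<noteq> {c, d} \<Longrightarrow> separated_edges a b c d"
    and arcs_avoid_faces: "f \<in> set fs \<Longrightarrow> (a, b) \<in> face_arcs fs bs \<Longrightarrow>
      \<exists>(u, v)\<in>set (darts f). orient u v a \<le> 0 \<and> orient u v b \<le> 0"
    and boundary_verts_subset: "set bs \<subseteq> face_verts fs"
begin

abbreviation "V \<equiv> face_verts fs"
abbreviation "E \<equiv> face_arcs fs bs"
abbreviation "G \<equiv> face_graph fs bs"

lemma finite_V: "finite V" and finite_E: "finite E"
  by (auto simp: face_verts_def face_arcs_def)

lemma boundary_convex: "convex_polygon bs"
  using boundary_distinct boundary_pos boundary_verts_subset unfolding convex_polygon_def by blast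

lemma dart_in_E: "f \<in> set fs \<Longrightarrow> (u, v) \<in> set (darts f) \<Longrightarrow> (u, v) \<in> E"
  and boundary_dart_in_E: "(u, v) \<in> set (darts bs) \<Longrightarrow> (u, v) \<in> E"
  using arcs_sym[of v u] by (auto simp: face_arcs_def)

lemma E_neq: "(u, v) \<in> E \<Longrightarrow> u \<noteq> v"
  using polygon_dart_neq[OF face_convex] polygon_dart_neq[OF boundary_convex]
  by (fastforce simp: face_arcs_def)

lemma E_verts: "(u, v) \<in> E \<Longrightarrow> u \<in> V \<and> v \<in> V"
  using boundary_verts_subset by (auto simp: face_arcs_def face_verts_def dest: dartsD)

lemma V_arc: "u \<in> V \<Longrightarrow> \<exists>v. (u, v) \<in> E"
  unfolding face_verts_def using darts_out dart_in_E by fast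

lemma pair_graph_G: "pair_graph G"
proof
  show "finite (pverts G)" "finite (parcs G)" using finite_V finite_E by simp_all
  show "fst e \<in> pverts G" "snd e \<in> pverts G" "fst e \<noteq> snd e" if "e \<in> parcs G" for e
    using that E_verts E_neq by (cases e; force)+
  show "symmetric (with_proj G)"
    by (auto simp: symmetric_def intro!: symI arcs_sym)
qed

lemma uedges_G: "uedges G = {{u, v} | u v. (u, v) \<in> E}"
  by (simp add: uedges_def)

text \<open>
  A vertex is an end point of some edge, so the disjointness of edges also keeps vertices off them.
\<close>

lemma vertex_on_edge:
  assumes "(u, v) \<in> E" "w \<in> V" "w \<in> closed_segment u v"
  shows "w = u \<or> w = v"
proof (rule ccontr)
  assume n: "\<not> ?thesis"
  obtain x where x: "(w, x) \<in> E" using V_arc assms(2) by blast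
  have "open_segment u v \<inter> closed_segment w x = {}"
    using n by (intro separated_edgesD arcs_separated assms x) auto
  moreover have "w \<in> open_segment u v" using n assms(3) by (simp add: open_segment_def)
  ultimately show False by auto
qed

lemma plane_graph_G: "plane_graph G straight_edge"
  unfolding plane_graph_def
proof (intro conjI ballI impI pair_graph_G)
  fix e assume "e \<in> uedges G"
  then obtain u v where e: "e = {u, v}" and uv: "(u, v) \<in> E" by (auto simp: uedges_G)
  show "arc (straight_edge e)" using E_neq[OF uv] by (simp add: e arc_straight_edge)
  show "{pathstart (straight_edge e), pathfinish (straight_edge e)} = e"
    by (simp only: e ends_straight_edge)
  have inner: "path_image (straight_edge e) - e = open_segment u v"
    by (simp add: e open_segment_def)
  show "(path_image (straight_edge e) - e) \<inter> pverts G = {}"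
    unfolding inner using vertex_on_edge[OF uv] by (auto simp: open_segment_def)
  fix f assume "f \<in> uedges G" "f \<noteq> e"
  then obtain x y where f: "f = {x, y}" and xy: "(x, y) \<in> E" by (auto simp: uedges_G)
  show "(path_image (straight_edge e) - e) \<inter> path_image (straight_edge f) = {}"
    unfolding inner using separated_edgesD[OF arcs_separated[OF uv xy]] \<open>f \<noteq> e\<close> by (simp add: e f)
qed

definition D :: "complex set" where
  "D = (\<Union>(u, v)\<in>E. closed_segment u v)"

lemma drawing_G: "drawing G straight_edge = D"
proof -
  have "V \<subseteq> D"
  proof
    fix u assume "u \<in> V"
    then obtain v where "(u, v) \<in> E" using V_arc by blast
    then show "u \<in> D" unfolding D_def by (intro UN_I[of "(u, v)"]) auto
  qed
  moreover have "(\<Union>e\<in>uedges G. path_image (straight_edge e)) = D"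
  proof -
    have "uedges G = (\<lambda>d. {fst d, snd d}) ` E" by (force simp: uedges_G)
    then show ?thesis by (simp add: D_def case_prod_beta)
  qed
  ultimately show ?thesis by (auto simp: drawing_def)
qed

lemma polygon_boundary_face_D: "f \<in> set fs \<Longrightarrow> polygon_boundary f \<subseteq> D"
  unfolding polygon_boundary_def D_def by (rule UN_mono) (auto dest: dart_in_E)

lemma polygon_boundary_outer_D: "polygon_boundary bs \<subseteq> D"
  unfolding polygon_boundary_def D_def by (rule UN_mono) (auto dest: boundary_dart_in_E)

lemma V_outer: "w \<in> V \<Longrightarrow> w \<in> closure (polygon_interior bs)"
  unfolding closure_polygon_interior[OF boundary_convex]
  using boundary_pos by (force simp: less_le)

lemma D_outer: "D \<subseteq> closure (polygon_interior bs)"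
proof -
  have "convex (closure (polygon_interior bs))"
    by (intro convex_closure convex_polygon_interior)
  then show ?thesis
    unfolding D_def by (auto dest!: E_verts V_outer intro: closed_segment_subset[THEN subsetD])
qed

lemma D_face: 
  assumes "f \<in> set fs" shows "polygon_interior f \<inter> D = {}"
proof (rule ccontr)
  assume "\<not> ?thesis"
  then obtain z a b where z: "z \<in> polygon_interior f" "(a, b) \<in> E" "z \<in> closed_segment a b"
    by (auto simp: D_def)
  obtain u v where uv: "(u, v) \<in> set (darts f)" "orient u v a \<le> 0" "orient u v b \<le> 0"
    using arcs_avoid_faces[OF assms z(2)] by blast
  obtain t where "0 \<le> t" "t \<le> 1" "orient u v z = (1 - t) * orient u v a + t * orient u v b"
    using orient_closed_segment[OF z(3)] by blast
  with uv have "orient u v z \<le> 0" by (simp add: add_nonpos_nonpos mult_nonneg_nonpos)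
  then show False using z(1) uv(1) by (force simp: polygon_interior_def)
qed

lemma face_component: "f \<in> set fs \<Longrightarrow> polygon_interior f \<in> components (- D)"
  by (intro component_if_frontier_subset D_face)
     (auto simp: frontier_polygon_interior face_convex convex_connected convex_polygon_interior
        polygon_interior_nonempty dest: polygon_boundary_face_D)

definition outer :: "complex set" where
  "outer = - closure (polygon_interior bs)"

lemma bounded_outer_complement: "bounded (- outer)"
  by (simp add: outer_def bounded_closure bounded_polygon_interior boundary_convex)

lemma frontier_outer: "frontier outer = polygon_boundary bs"
proof -
  have "interior (closure (polygon_interior bs)) = polygon_interior bs"
    by (simp add: convex_interior_closure convex_polygon_interior interior_open open_polygon_interior)
  then have "frontier outer = frontier (polygon_interior bs)"
    by (simp add: outer_def frontier_complement) (simp add: frontier_def interior_open open_polygon_interior)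
  then show ?thesis by (simp add: frontier_polygon_interior boundary_convex)
qed

lemma connected_outer: "Topological_Spaces.connected outer"
  unfolding outer_def using bounded_polygon_interior[OF boundary_convex]
  by (intro connected_complement_bounded_convex) (auto intro: convex_closure convex_polygon_interior)

lemma outer_component: "outer \<in> components (- D)"
proof (intro component_if_frontier_subset connected_outer)
  show "outer \<noteq> {}" using bounded_outer_complement by (metis Compl_empty_eq not_bounded_UNIV)
  show "outer \<inter> D = {}" using D_outer by (auto simp: outer_def)
  show "frontier outer \<subseteq> D" using frontier_outer polygon_boundary_outer_D by simp
qed

lemma outer_face_G: "outer_face G straight_edge = outer"
proof -
  have "z \<in> outside D \<longleftrightarrow> z \<in> outer" for z
  proof
    assume z: "z \<in> outer"
    then have "outer \<subseteq> connected_component_set (- D) z"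
      using outer_component connected_outer in_components_subset connected_component_maximal by metis
    moreover have "\<not> bounded outer"
      using bounded_outer_complement cobounded_imp_unbounded by blast
    moreover have "z \<notin> D" using z D_outer by (auto simp: outer_def)
    ultimately show "z \<in> outside D" by (auto simp: outside dest: bounded_subset)
  next
    assume z: "z \<in> outside D"
    then have zD: "z \<notin> D" by (auto simp: outside_def)
    show "z \<in> outer"
    proof (rule ccontr)
      assume "z \<notin> outer"
      moreover have "z \<in> connected_component_set (- D) z"
        using zD by (simp add: connected_component_refl_eq)
      ultimately have "connected_component_set (- D) z \<inter> - outer \<noteq> {}" by blast
      moreover have "connected_component_set (- D) z \<inter> frontier (- outer) = {}"
        using frontier_outer polygon_boundary_outer_D connected_component_subset
        by (fastforce simp: frontier_complement)
      ultimately have "connected_component_set (- D) z \<subseteq> - outer"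
        using connected_Int_frontier[of "connected_component_set (- D) z" "- outer"] by auto
      then show False
        using z bounded_outer_complement bounded_subset by (auto simp: outside)
    qed
  qed
  then show ?thesis by (auto simp: outer_face_def drawing_G)
qed

text \<open>
  The centroid of the vertices of \<open>f\<close> lies in both, since no side of either polygon contains all of
  these vertices.
\<close>

lemma face_meets_outer_polygon:
  assumes f: "f \<in> set fs"
  shows "polygon_interior f \<inter> polygon_interior bs \<noteq> {}"
proof -
  let ?c = "(\<Sum>a\<in>set f. a) /\<^sub>R real (card (set f))"
  have fV: "set f \<subseteq> V" using f by (auto simp: face_verts_def)
  have "?c \<in> polygon_interior f"
    unfolding polygon_interior_def
  proof safe
    fix u v assume uv: "(u, v) \<in> set (darts f)"
    obtain w where "w \<in> set f" "w \<noteq> u" "w \<noteq> v" using polygon_third_vertex[OF face_convex[OF f]] by blast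
    with uv f show "0 < orient u v ?c"
      by (intro centroid_orient_pos[of _ w]) (auto intro: polygon_nonneg polygon_pos face_convex)
  qed
  moreover have "?c \<in> polygon_interior bs"
    unfolding polygon_interior_def
  proof safe
    fix u v assume uv: "(u, v) \<in> set (darts bs)"
    obtain w where w: "w \<in> set f" "w \<noteq> u" "w \<noteq> v" using polygon_third_vertex[OF face_convex[OF f]] by blast
    have nonneg: "0 \<le> orient u v a" if "a \<in> set f" for a
      using boundary_pos[OF uv, of a] fV that by (cases "a = u \<or> a = v") auto
    show "0 < orient u v ?c"
      using w fV uv by (intro centroid_orient_pos[of _ w] nonneg boundary_pos) auto
  qed
  ultimately show ?thesis by blast
qed

text \<open>
  The heart of the topological argument. Without the vertices, the interior of the outer polygon is
  still connected. The part of it covered by the closed faces is closed, not empty, and open: at an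
  inner point of an edge, the faces on both sides cover a half-disc each.
\<close>

lemma closed_faces_cover:
  "polygon_interior bs - V \<subseteq> (\<Union>f\<in>set fs. closure (polygon_interior f))" (is "?S \<subseteq> ?U")
proof -
  have local: "z \<in> interior ?U" if z: "z \<in> ?S" "z \<in> ?U" for z
  proof -
    obtain f where f: "f \<in> set fs" "z \<in> closure (polygon_interior f)" using z(2) by blast
    show ?thesis
    proof (cases "z \<in> polygon_interior f")
      case True
      have "polygon_interior f \<subseteq> ?U" using f(1) closure_subset by fast
      then show ?thesis using True interior_maximal[OF _ open_polygon_interior] by blast
    next
      case False
      then have "z \<in> polygon_boundary f"
        using f(2) frontier_polygon_interior[OF face_convex[OF f(1)]]
        by (auto simp: frontier_def interior_open open_polygon_interior)
      then obtain u v where uv: "(u, v) \<in> set (darts f)" "z \<in> closed_segment u v"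
        by (auto simp: polygon_boundary_def)
      have "u \<in> V" "v \<in> V" using E_verts dart_in_E[OF f(1) uv(1)] by auto
      then have seg: "z \<in> open_segment u v" using uv(2) z(1) by (auto simp: open_segment_def)
      have on_line: "orient u v z = 0" using orient_open_segment[OF seg] by auto
      then have "(u, v) \<notin> set (darts bs)" using z(1) by (force simp: polygon_interior_def)
      then obtain g where g: "g \<in> set fs" "(v, u) \<in> set (darts g)"
        using arcs_sym[OF dart_in_E[OF f(1) uv(1)]] by (auto simp: face_arcs_def)
      obtain T where T: "open T" "z \<in> T"
        "\<And>x. x \<in> T \<Longrightarrow> 0 \<le> orient u v x \<Longrightarrow> x \<in> closure (polygon_interior f)"
        using half_neighbourhood[OF face_convex[OF f(1)] uv(1) seg] by blast
      obtain T' where T': "open T'" "z \<in> T'"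
        "\<And>x. x \<in> T' \<Longrightarrow> 0 \<le> orient v u x \<Longrightarrow> x \<in> closure (polygon_interior g)"
        using half_neighbourhood[OF face_convex[OF g(1)] g(2)] seg by (metis open_segment_commute)
      have "T \<inter> T' \<subseteq> ?U"
      proof
        fix x assume x: "x \<in> T \<inter> T'"
        show "x \<in> ?U"
          using T(3)[of x] T'(3)[of x] x f(1) g(1) orient_swap[of v u x]
          by (cases "0 \<le> orient u v x") auto
      qed
      then show ?thesis
        using T(1,2) T'(1,2) interior_maximal[of "T \<inter> T'" ?U] open_Int[of T T'] by blast
    qed
  qed
  have "Topological_Spaces.connected ?S"
    by (intro connected_open_delete_finite open_polygon_interior convex_connected
        convex_polygon_interior finite_V) simp
  moreover have "closedin (top_of_set ?S) (?S \<inter> ?U)"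
    by (intro closedin_closed_Int closed_UN) auto
  moreover have "openin (top_of_set ?S) (?S \<inter> ?U)"
  proof -
    have "?S \<inter> ?U = ?S \<inter> interior ?U" using local interior_subset by blast
    then show ?thesis by (metis open_interior openin_open_Int)
  qed
  moreover have "?S \<inter> ?U \<noteq> {}"
  proof -
    obtain f where f: "f \<in> set fs" using faces_nonempty by (meson list.set_sel(1))
    obtain z where z: "z \<in> polygon_interior f" "z \<in> polygon_interior bs"
      using face_meets_outer_polygon[OF f] by blast
    have "V \<subseteq> D" using drawing_G by (auto simp: drawing_def)
    then have "z \<notin> V" using D_face[OF f] z(1) by blast
    then show ?thesis using z f closure_subset by fast
  qed
  ultimately have "?S \<inter> ?U = ?S" unfolding connected_clopen by blast
  then show ?thesis by blast
qed

text \<open>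
  Each listed set is a component of the complement of the drawing, and together they exhaust the
  complement.
\<close>

lemma faces_G: "Defs.faces G straight_edge = insert outer (polygon_interior ` set fs)"
proof -
  have "C \<in> insert outer (polygon_interior ` set fs)" if C: "C \<in> components (- D)" for C
  proof -
    obtain z where z: "z \<in> C" using C in_components_nonempty by blast
    then have zD: "z \<notin> D" using C in_components_subset by blast
    have "\<exists>X\<in>insert outer (polygon_interior ` set fs). z \<in> X"
    proof (cases "z \<in> outer")
      case False
      then have "z \<in> polygon_interior bs"
        using zD polygon_boundary_outer_D frontier_polygon_interior[OF boundary_convex]
        by (auto simp: outer_def frontier_def interior_open open_polygon_interior)
      moreover have "V \<subseteq> D" using drawing_G by (auto simp: drawing_def)
      ultimately obtain f where f: "f \<in> set fs" "z \<in> closure (polygon_interior f)"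
        using closed_faces_cover zD by blast
      then have "z \<in> polygon_interior f"
        using zD polygon_boundary_face_D[OF f(1)] frontier_polygon_interior[OF face_convex[OF f(1)]]
        by (auto simp: frontier_def interior_open open_polygon_interior)
      with f(1) show ?thesis by blast
    qed auto
    then obtain X where X: "X \<in> insert outer (polygon_interior ` set fs)" "z \<in> X" by blast
    then have "X \<in> components (- D)" using outer_component face_component by auto
    then have "C = X" using C z X(2) components_nonoverlap by blast
    with X(1) show ?thesis by simp
  qed
  then show ?thesis
    using outer_component face_component by (auto simp: Defs.faces_def drawing_G)
qed

lemma internal_faces_G: "internal_faces G straight_edge = polygon_interior ` set fs"
proof -
  have "outer \<notin> polygon_interior ` set fs"
    using face_meets_outer_polygon closure_subset unfolding outer_def by fastforce
  then show ?thesis by (simp add: internal_faces_def faces_G outer_face_G)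
qed

lemma face_bounded_by_cycle:
  assumes f: "f \<in> set fs"
  shows "bounded_by_cycle G straight_edge (length f) (polygon_interior f)"
proof -
  have "pre_digraph.cycle (with_proj G) (darts f)"
    using f polygon_distinct[OF face_convex[OF f]] polygon_length[OF face_convex[OF f]]
    by (intro cycle_darts) (auto simp: face_verts_def intro: dart_in_E)
  then show ?thesis
    unfolding bounded_by_cycle_def using polygon_length[OF face_convex[OF f]]
    by (auto simp: frontier_polygon_interior face_convex[OF f] polygon_boundary_def intro!: exI[of _ "darts f"])
qed

lemma simple_closed_boundary_G: "simple_closed_boundary G straight_edge"
proof -
  have "pre_digraph.cycle (with_proj G) (darts bs)"
    using boundary_distinct boundary_verts_subset
    by (intro cycle_darts) (auto intro: boundary_dart_in_E)
  then show ?thesis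
    unfolding simple_closed_boundary_def bounded_by_cycle_def using boundary_distinct
    by (auto simp: outer_face_G frontier_outer polygon_boundary_def intro!: exI[of _ "darts bs"])
qed

lemma V_polygon_boundary:
  assumes "set (darts ps) \<subseteq> E"
  shows "V \<inter> polygon_boundary ps = set ps"
proof
  show "V \<inter> polygon_boundary ps \<subseteq> set ps"
    using assms vertex_on_edge by (fastforce simp: polygon_boundary_def dest: dartsD)
  show "set ps \<subseteq> V \<inter> polygon_boundary ps"
  proof
    fix u assume "u \<in> set ps"
    then obtain v where v: "(u, v) \<in> set (darts ps)" using darts_out by fast
    then have "u \<in> polygon_boundary ps" unfolding polygon_boundary_def by (intro UN_I[of "(u, v)"]) auto
    moreover have "u \<in> V" using v assms E_verts by blast
    ultimately show "u \<in> V \<inter> polygon_boundary ps" by simp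
  qed
qed

lemma boundary_verts_G: "boundary_verts G straight_edge = set bs"
  using V_polygon_boundary[of bs] boundary_dart_in_E
  by (simp add: boundary_verts_def outer_face_G frontier_outer subrelI)

lemma V_frontier_face: "f \<in> set fs \<Longrightarrow> V \<inter> frontier (polygon_interior f) = set f"
  using V_polygon_boundary[of f] dart_in_E
  by (simp add: frontier_polygon_interior face_convex subrelI)

text \<open>
  A face is recovered from its interior through the vertices on the frontier.
\<close>

lemma inj_on_polygon_interior: "inj_on polygon_interior (set fs)"
proof (rule inj_onI)
  fix f g assume fg: "f \<in> set fs" "g \<in> set fs" "polygon_interior f = polygon_interior g"
  then have "set f = set g" using V_frontier_face by metis
  then show "f = g" using faces_distinct fg(1,2) by (auto simp: distinct_map dest: inj_onD)
qed

lemma count_faces_at_vertex: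
  assumes "v \<in> V"
  shows "length (filter (\<lambda>f. length f = k \<and> v \<in> set f) fs)
    \<le> card {F \<in> Defs.faces G straight_edge. bounded_by_cycle G straight_edge k F \<and> v \<in> frontier F}"
proof -
  let ?L = "{f \<in> set fs. length f = k \<and> v \<in> set f}"
  have "length (filter (\<lambda>f. length f = k \<and> v \<in> set f) fs) = card ?L"
    using faces_distinct distinct_card[of "filter (\<lambda>f. length f = k \<and> v \<in> set f) fs"]
    by (simp add: distinct_map)
  also have "\<dots> = card (polygon_interior ` ?L)"
    by (intro card_image[symmetric] inj_on_subset[OF inj_on_polygon_interior]) auto
  also have "\<dots> \<le> card {F \<in> Defs.faces G straight_edge. bounded_by_cycle G straight_edge k F \<and> v \<in> frontier F}"
    using face_bounded_by_cycle V_frontier_face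
    by (intro card_mono) (auto simp: faces_G)
  finally show ?thesis .
qed

lemma tri_count_G:
  "v \<in> V \<Longrightarrow> length (filter (\<lambda>f. length f = 3 \<and> v \<in> set f) fs) \<le> tri_count G straight_edge v"
  and quad_count_G:
  "v \<in> V \<Longrightarrow> length (filter (\<lambda>f. length f = 4 \<and> v \<in> set f) fs) \<le> quad_count G straight_edge v"
  using count_faces_at_vertex[of v 3] count_faces_at_vertex[of v 4]
  by (simp_all add: tri_count_def quad_count_def triangles_def quadrangles_def conj_assoc)

lemma internal_faces_triangles_quadrangles:
  assumes "\<And>f. f \<in> set fs \<Longrightarrow> length f = 3 \<or> length f = 4"
  shows "internal_faces G straight_edge \<subseteq> triangles G straight_edge \<union> quadrangles G straight_edge"
  using assms face_bounded_by_cycle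
  by (fastforce simp: internal_faces_G triangles_def quadrangles_def faces_G)

end

section \<open>Distances through reflexive powers\<close>

lemma relpow_iff_awalk:
  assumes "pair_wf_digraph G" "u \<in> pverts G"
  shows "(u, v) \<in> parcs G ^^ k \<longleftrightarrow> (\<exists>p. pre_digraph.awalk (with_proj G) u p v \<and> length p = k)"
proof -
  interpret pair_wf_digraph G by fact
  show ?thesis
    using assms(2)
  proof (induction k arbitrary: u)
    case 0
    then show ?case by (auto simp: awalk_Nil_iff)
  next
    case (Suc k)
    have "(u, v) \<in> parcs G ^^ Suc k \<longleftrightarrow> (\<exists>w. (u, w) \<in> parcs G \<and> (w, v) \<in> parcs G ^^ k)"
      using relpow_Suc_D2 relpow_Suc_I2 by metis
    also have "\<dots> \<longleftrightarrow> (\<exists>w. (u, w) \<in> parcs G \<and> (\<exists>p. awalk w p v \<and> length p = k))"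
      using Suc.IH in_arcsD2 by blast
    also have "\<dots> \<longleftrightarrow> (\<exists>p. awalk u p v \<and> length p = Suc k)"
    proof (intro iffI; elim exE conjE)
      fix w p assume "(u, w) \<in> parcs G" "awalk w p v" "length p = k"
      then show "\<exists>p. awalk u p v \<and> length p = Suc k"
        by (intro exI[of _ "(u, w) # p"]) (simp add: awalk_Cons_iff)
    next
      fix p assume "awalk u p v" "length p = Suc k"
      then show "\<exists>w. (u, w) \<in> parcs G \<and> (\<exists>p. awalk w p v \<and> length p = k)"
        by (cases p) (fastforce simp: awalk_Cons_iff)+
    qed
    finally show ?case .
  qed
qed

lemma graph_dist_relpow:
  assumes "pair_wf_digraph G" "u \<in> pverts G"
  shows "graph_dist G u v = (INF k\<in>{k. (u, v) \<in> parcs G ^^ k}. ereal (real k))"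
proof -
  interpret pair_wf_digraph G by fact
  have "awalk_cost (\<lambda>_. 1) p = length p" for p by (induction p) auto
  moreover have "{k. (u, v) \<in> parcs G ^^ k} = length ` {p. awalk u p v}"
    using relpow_iff_awalk[OF assms] by auto
  ultimately show ?thesis
    by (simp add: graph_dist_def \<mu>_def image_comp)
qed

text \<open>
  Distances are expressed through powers of the reflexive closure, because these grow with the exponent:
  once all relevant vertices are reached, no larger exponent needs to be examined.
\<close>

lemma relpow_reflcl_imp_relpow:
  "(u, v) \<in> (R\<^sup>=) ^^ k \<Longrightarrow> \<exists>j\<le>k. (u, v) \<in> R ^^ j"
proof (induction k arbitrary: v)
  case (Suc k)
  then obtain w where w: "(u, w) \<in> (R\<^sup>=) ^^ k" "(w, v) \<in> R\<^sup>=" by auto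
  then obtain j where "j \<le> k" "(u, w) \<in> R ^^ j" using Suc.IH by blast
  then have "(u, v) \<in> R ^^ j \<or> (u, v) \<in> R ^^ Suc j" using w(2) by auto
  with \<open>j \<le> k\<close> show ?case by (meson Suc_le_mono le_SucI)
qed auto

lemma graph_dist_reflcl_relpow:
  assumes "pair_wf_digraph G" "u \<in> pverts G"
  shows "graph_dist G u v = (INF k\<in>{k. (u, v) \<in> ((parcs G)\<^sup>=) ^^ k}. ereal (real k))"
  unfolding graph_dist_relpow[OF assms]
proof (rule antisym)
  show "(INF k\<in>{k. (u, v) \<in> parcs G ^^ k}. ereal (real k))
      \<le> (INF k\<in>{k. (u, v) \<in> ((parcs G)\<^sup>=) ^^ k}. ereal (real k))"
    using relpow_reflcl_imp_relpow by (intro INF_mono) fastforce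
  have "parcs G ^^ k \<subseteq> ((parcs G)\<^sup>=) ^^ k" for k
    by (induction k) auto
  then show "(INF k\<in>{k. (u, v) \<in> ((parcs G)\<^sup>=) ^^ k}. ereal (real k))
      \<le> (INF k\<in>{k. (u, v) \<in> parcs G ^^ k}. ereal (real k))"
    by (intro INF_superset_mono) blast+
qed

lemma relpow_Suc_iff: "(x, y) \<in> S ^^ Suc k \<longleftrightarrow> (\<exists>z. (x, z) \<in> S ^^ k \<and> (z, y) \<in> S)"
  by auto

lemma relpow_map_prod:
  assumes "inj g"
  shows "(g u, g v) \<in> ((map_prod g g ` R)\<^sup>=) ^^ k \<longleftrightarrow> (u, v) \<in> (R\<^sup>=) ^^ k"
proof -
  define S where "S = (map_prod g g ` R)\<^sup>="
  define Q where "Q = R\<^sup>="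
  have step: "(g w, y) \<in> S \<longleftrightarrow> (\<exists>x. y = g x \<and> (w, x) \<in> Q)" for w y
    using assms by (auto simp: S_def Q_def dest: injD)
  have "(g u, y) \<in> S ^^ k \<longleftrightarrow> (\<exists>w. y = g w \<and> (u, w) \<in> Q ^^ k)" for y
  proof (induction k arbitrary: y)
    case (Suc k)
    define P where "P w \<longleftrightarrow> (u, w) \<in> Q ^^ k" for w
    have "(g u, y) \<in> S ^^ Suc k \<longleftrightarrow> (\<exists>z. (\<exists>w. z = g w \<and> P w) \<and> (z, y) \<in> S)"
      unfolding relpow_Suc_iff Suc.IH P_def ..
    also have "\<dots> \<longleftrightarrow> (\<exists>x. y = g x \<and> (\<exists>w. P w \<and> (w, x) \<in> Q))"
      using step by blast
    finally show ?case unfolding relpow_Suc_iff P_def .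
  qed auto
  then show ?thesis using assms unfolding S_def Q_def by (auto dest: injD)
qed

text \<open>
  The closed ball of radius \<open>k\<close> around \<open>s\<close>, in a form that can be evaluated.
\<close>

fun reached :: "('a \<times> 'a) list \<Rightarrow> 'a \<Rightarrow> nat \<Rightarrow> 'a list" where
  "reached es s 0 = [s]"
| "reached es s (Suc k) =
    (let W = reached es s k in remdups (W @ map snd (filter (\<lambda>e. fst e \<in> set W) es)))"

lemma set_reached: "set (reached es s k) = {t. (s, t) \<in> ((set es)\<^sup>=) ^^ k}"
proof (induction k)
  case (Suc k)
  have "t \<in> set (reached es s (Suc k)) \<longleftrightarrow>
      (\<exists>w. w \<in> set (reached es s k) \<and> (w, t) \<in> (set es)\<^sup>=)" for t
    by (force simp: Let_def)
  then show ?case unfolding relpow_Suc_iff Suc.IH by blast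
qed auto

lemma reached_mono: "k \<le> l \<Longrightarrow> set (reached es s k) \<subseteq> set (reached es s l)"
  by (induction rule: dec_induct) (auto simp: Let_def)

section \<open>An isomorphism invariant\<close>

text \<open>
  The isomorphism invariant that tells the two graphs apart: some vertex has all its neighbours among
  the neighbours of another vertex.
\<close>

definition has_dominated_vertex :: "'a pair_pre_digraph \<Rightarrow> bool" where
  "has_dominated_vertex G \<longleftrightarrow>
     (\<exists>z\<in>pverts G. \<exists>c\<in>pverts G. z \<noteq> c \<and> parcs G `` {z} \<subseteq> parcs G `` {c})"

lemma has_dominated_vertex_iso:
  assumes "digraph_iso (with_proj G) (with_proj H)" "has_dominated_vertex G"
  shows "has_dominated_vertex H"
proof -
  obtain h where h: "pre_digraph.digraph_isomorphism (with_proj G) h"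
    and H: "with_proj H = app_iso h (with_proj G)"
    using assms(1) by (auto simp: digraph_iso_def)
  interpret wf_digraph "with_proj G" using h by (simp add: pre_digraph.digraph_isomorphism_def)
  let ?f = "iso_verts h"
  have inj: "inj_on ?f (pverts G)"
    using h by (simp add: pre_digraph.digraph_isomorphism_def)
  have ends: "verts (with_proj H) = ?f ` pverts G" "arcs (with_proj H) = iso_arcs h ` parcs G"
      "tail (with_proj H) = iso_tail h" "head (with_proj H) = iso_head h"
    unfolding H by (simp_all add: app_iso_def)
  have "iso_arcs h a = (?f (fst a), ?f (snd a))" if "a \<in> parcs G" for a
    using h that ends(3,4) by (simp add: pre_digraph.digraph_isomorphism_def prod_eq_iff)
  then have parcs_H: "parcs H = (\<lambda>a. (?f (fst a), ?f (snd a))) ` parcs G"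
    using ends(2) by simp
  obtain z c where zc: "z \<in> pverts G" "c \<in> pverts G" "z \<noteq> c" "parcs G `` {z} \<subseteq> parcs G `` {c}"
    using assms(2) by (auto simp: has_dominated_vertex_def)
  have "parcs H `` {?f z} \<subseteq> parcs H `` {?f c}"
  proof
    fix y assume "y \<in> parcs H `` {?f z}"
    then obtain a b where ab: "(a, b) \<in> parcs G" "?f a = ?f z" "y = ?f b" by (auto simp: parcs_H)
    then have "a = z" using inj zc(1) wellformed[of "(a, b)"] by (auto dest: inj_onD)
    then have "(c, b) \<in> parcs G" using ab(1) zc(4) by blast
    then show "y \<in> parcs H `` {?f c}" using ab(3) by (force simp: parcs_H)
  qed
  moreover have "?f z \<noteq> ?f c" using inj zc by (auto dest: inj_onD)
  ultimately show ?thesis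
    using zc(1,2) ends(1) unfolding has_dominated_vertex_def by auto
qed

section \<open>Subdivisions with integer vertices\<close>

text \<open>
  Vertices at integer points turn all sign conditions into integer arithmetic.
\<close>

type_synonym lattice_point = "int \<times> int"

definition pt :: "lattice_point \<Rightarrow> complex" where
  "pt p = Complex (of_int (fst p)) (of_int (snd p))"

lemma inj_pt: "inj pt"
  by (auto simp: inj_def pt_def)

lemma pt_eq_iff [simp]: "pt p = pt q \<longleftrightarrow> p = q"
  using inj_pt by (auto dest: injD)

fun lattice_orient :: "lattice_point \<Rightarrow> lattice_point \<Rightarrow> lattice_point \<Rightarrow> int" where
  "lattice_orient (x, y) (x', y') (x'', y'') = (x' - x) * (y'' - y) - (y' - y) * (x'' - x)"

lemma orient_pt: "orient (pt a) (pt b) (pt c) = of_int (lattice_orient a b c)"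
  by (cases a; cases b; cases c) (simp add: orient_def pt_def)

text \<open>
  The arcs of \<open>face_graph\<close> once more, as a list for evaluation.
\<close>

definition arc_list :: "'a list list \<Rightarrow> 'a list \<Rightarrow> ('a \<times> 'a) list" where
  "arc_list fs bs = concat (map darts fs) @ map prod.swap (darts bs)"

lemma set_arc_list: "set (arc_list fs bs) = face_arcs fs bs"
  by (force simp: arc_list_def face_arcs_def)

abbreviation lattice_graph :: "lattice_point list list \<Rightarrow> lattice_point list \<Rightarrow> complex pair_pre_digraph" where
  "lattice_graph fs bs \<equiv> face_graph (map (map pt) fs) (map pt bs)"

lemma darts_map: "darts (map g ps) = map (map_prod g g) (darts ps)"
  by (simp add: darts_def rotate1_map zip_map_map map_prod_def)

lemma face_verts_map: "face_verts (map (map g) fs) = g ` face_verts fs"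
  by (auto simp: face_verts_def)

lemma face_arcs_map: "face_arcs (map (map g) fs) (map g bs) = map_prod g g ` face_arcs fs bs"
  by (force simp: face_arcs_def darts_map)

definition lattice_separated :: "lattice_point \<times> lattice_point \<Rightarrow> lattice_point \<times> lattice_point \<Rightarrow> bool" where
  "lattice_separated e f \<longleftrightarrow>
     (let (a, b) = e; (c, d) = f; p = lattice_orient c d a; q = lattice_orient c d b in
       0 \<le> p * q \<and> (p \<noteq> 0 \<or> q \<noteq> 0) \<or> 0 < lattice_orient a b c * lattice_orient a b d)"

text \<open>
  An executable form of the assumptions of \<^locale>\<open>polygon_subdivision\<close>.
\<close>

definition lattice_subdivision :: "lattice_point list list \<Rightarrow> lattice_point list \<Rightarrow> bool" where
  "lattice_subdivision fs bs \<longleftrightarrow>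
     fs \<noteq> [] \<and>
     (\<forall>f\<in>set fs. distinct f \<and> 3 \<le> length f \<and>
        (\<forall>(u, v)\<in>set (darts f). \<forall>w\<in>set f. w = u \<or> w = v \<or> 0 < lattice_orient u v w)) \<and>
     distinct (map set fs) \<and>
     distinct bs \<and> 3 \<le> length bs \<and> set bs \<subseteq> set (concat fs) \<and>
     (\<forall>(u, v)\<in>set (darts bs). \<forall>w\<in>set (concat fs). w = u \<or> w = v \<or> 0 < lattice_orient u v w) \<and>
     (\<forall>(u, v)\<in>set (arc_list fs bs). (v, u) \<in> set (arc_list fs bs)) \<and>
     (\<forall>e\<in>set (arc_list fs bs). \<forall>e'\<in>set (arc_list fs bs).
        e' = e \<or> e' = prod.swap e \<or> lattice_separated e e') \<and>
     (\<forall>f\<in>set fs. \<forall>(a, b)\<in>set (arc_list fs bs).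
        \<exists>(u, v)\<in>set (darts f). lattice_orient u v a \<le> 0 \<and> lattice_orient u v b \<le> 0)"

lemma convex_polygon_map_pt:
  "convex_polygon (map pt f) \<longleftrightarrow> distinct f \<and> 3 \<le> length f \<and>
     (\<forall>(u, v)\<in>set (darts f). \<forall>w\<in>set f. w = u \<or> w = v \<or> 0 < lattice_orient u v w)"
proof -
  have "(\<forall>w\<in>pt ` set f - {pt a, pt b}. 0 < orient (pt a) (pt b) w) \<longleftrightarrow>
      (\<forall>w\<in>set f. w = a \<or> w = b \<or> 0 < lattice_orient a b w)" for a b
  proof -
    have "pt ` set f - {pt a, pt b} = pt ` (set f - {a, b})" by auto
    then show ?thesis by (auto simp: orient_pt simp del: split_paired_All)
  qed
  then show ?thesis
    unfolding convex_polygon_def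
    by (simp add: darts_map distinct_map inj_on_def case_prod_beta)
qed

lemma polygon_subdivision_lattice:
  assumes sub: "lattice_subdivision fs bs"
  shows "polygon_subdivision (map (map pt) fs) (map pt bs)"
proof
  note defs = lattice_subdivision_def set_arc_list
  have arcs_map: "face_arcs (map (map pt) fs) (map pt bs) = map_prod pt pt ` face_arcs fs bs"
    by (rule face_arcs_map)
  show "map (map pt) fs \<noteq> []" using sub by (simp add: defs)
  have "distinct (map set fs)" using sub unfolding defs by (elim conjE)
  then show "distinct (map set (map (map pt) fs))"
    using inj_image_eq_iff[OF inj_pt] by (simp add: distinct_map inj_on_def)
  have "distinct bs" using sub unfolding defs by (elim conjE)
  moreover have "3 \<le> length bs" using sub unfolding defs by (elim conjE)
  ultimately show "distinct (map pt bs)" "3 \<le> length (map pt bs)"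
    by (simp_all add: distinct_map inj_on_def)
  have "set bs \<subseteq> face_verts fs" using sub unfolding defs face_verts_def by simp
  then show "set (map pt bs) \<subseteq> face_verts (map (map pt) fs)"
    unfolding face_verts_map by auto
  show "convex_polygon f" if f: "f \<in> set (map (map pt) fs)" for f
  proof -
    obtain g where g: "f = map pt g" "g \<in> set fs" using f by auto
    have "\<forall>f\<in>set fs. distinct f \<and> 3 \<le> length f \<and>
        (\<forall>(u, v)\<in>set (darts f). \<forall>w\<in>set f. w = u \<or> w = v \<or> 0 < lattice_orient u v w)"
      using sub unfolding defs by (elim conjE)
    then show ?thesis
      unfolding g(1) convex_polygon_map_pt using g(2) by (rule bspec)
  qed
  show "0 < orient u v w"
    if d: "(u, v) \<in> set (darts (map pt bs))" and w: "w \<in> face_verts (map (map pt) fs) - {u, v}" for u v w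
  proof -
    obtain a b where ab: "u = pt a" "v = pt b" "(a, b) \<in> set (darts bs)"
      using d by (auto simp: darts_map)
    obtain c where c: "w = pt c" "c \<in> set (concat fs)"
      using w by (auto simp: face_verts_map face_verts_def)
    have "\<forall>(u, v)\<in>set (darts bs). \<forall>w\<in>set (concat fs). w = u \<or> w = v \<or> 0 < lattice_orient u v w"
      using sub unfolding defs by (elim conjE)
    then have "c = a \<or> c = b \<or> 0 < lattice_orient a b c" using ab(3) c(2) by blast
    then show ?thesis using w by (auto simp: ab c orient_pt)
  qed
  show "(v, u) \<in> face_arcs (map (map pt) fs) (map pt bs)"
    if "(u, v) \<in> face_arcs (map (map pt) fs) (map pt bs)" for u v
  proof -
    obtain a b where ab: "u = pt a" "v = pt b" "(a, b) \<in> face_arcs fs bs"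
      using \<open>(u, v) \<in> _\<close> by (auto simp: arcs_map)
    have "\<forall>(u, v)\<in>face_arcs fs bs. (v, u) \<in> face_arcs fs bs"
      using sub unfolding defs by (elim conjE)
    then have "(b, a) \<in> face_arcs fs bs" using ab(3) by blast
    then show ?thesis unfolding arcs_map ab(1,2) by (rule rev_image_eqI) simp
  qed
  show "separated_edges a b c d"
    if ab: "(a, b) \<in> face_arcs (map (map pt) fs) (map pt bs)"
      and cd: "(c, d) \<in> face_arcs (map (map pt) fs) (map pt bs)" and ne: "{a, b} \<noteq> {c, d}" for a b c d
  proof -
    obtain a' b' where ab': "a = pt a'" "b = pt b'" "(a', b') \<in> face_arcs fs bs"
      using ab by (auto simp: arcs_map)
    obtain c' d' where cd': "c = pt c'" "d = pt d'" "(c', d') \<in> face_arcs fs bs"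
      using cd by (auto simp: arcs_map)
    have "\<forall>e\<in>face_arcs fs bs. \<forall>e'\<in>face_arcs fs bs.
        e' = e \<or> e' = prod.swap e \<or> lattice_separated e e'"
      using sub unfolding defs by (elim conjE)
    from bspec[OF bspec[OF this ab'(3)] cd'(3)]
    have "(c', d') = (a', b') \<or> (c', d') = (b', a') \<or> lattice_separated (a', b') (c', d')" by simp
    then have "lattice_separated (a', b') (c', d')" using ne by (auto simp: ab' cd')
    then show ?thesis
      unfolding ab'(1,2) cd'(1,2) separated_edges_def orient_pt lattice_separated_def Let_def
      by (simp flip: of_int_mult)
  qed
  show "\<exists>(u, v)\<in>set (darts f). orient u v a \<le> 0 \<and> orient u v b \<le> 0"
    if f: "f \<in> set (map (map pt) fs)" and ab: "(a, b) \<in> face_arcs (map (map pt) fs) (map pt bs)" for f a b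
  proof -
    obtain g where g: "f = map pt g" "g \<in> set fs" using f by auto
    obtain a' b' where ab': "a = pt a'" "b = pt b'" "(a', b') \<in> face_arcs fs bs"
      using ab by (auto simp: arcs_map)
    have "\<forall>f\<in>set fs. \<forall>(a, b)\<in>face_arcs fs bs.
        \<exists>(u, v)\<in>set (darts f). lattice_orient u v a \<le> 0 \<and> lattice_orient u v b \<le> 0"
      using sub unfolding defs by (elim conjE)
    then obtain u v where uv: "(u, v) \<in> set (darts g)" "lattice_orient u v a' \<le> 0" "lattice_orient u v b' \<le> 0"
      using g(2) ab'(3) by blast
    show ?thesis
    proof (rule bexI)
      show "(pt u, pt v) \<in> set (darts f)" using uv(1) by (force simp: g(1) darts_map)
      show "case (pt u, pt v) of (u, v) \<Rightarrow> orient u v a \<le> 0 \<and> orient u v b \<le> 0"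
        using uv(2,3) by (simp add: ab'(1,2) orient_pt)
    qed
  qed
qed

definition nonpositive_curvature :: "lattice_point list list \<Rightarrow> lattice_point list \<Rightarrow> bool" where
  "nonpositive_curvature fs bs \<longleftrightarrow> (\<forall>v\<in>set (concat fs). v \<in> set bs \<or>
     12 \<le> 2 * length (filter (\<lambda>f. length f = 3 \<and> v \<in> set f) fs)
         + 3 * length (filter (\<lambda>f. length f = 4 \<and> v \<in> set f) fs))"

lemma lattice_graph_properties:
  assumes sub: "lattice_subdivision fs bs"
    and "\<forall>f\<in>set fs. length f = 3 \<or> length f = 4" and "nonpositive_curvature fs bs"
  shows "plane_graph (lattice_graph fs bs) straight_edge"
    and "simple_closed_boundary (lattice_graph fs bs) straight_edge"
    and "internal_faces (lattice_graph fs bs) straight_edge \<subseteq>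
      triangles (lattice_graph fs bs) straight_edge \<union> quadrangles (lattice_graph fs bs) straight_edge"
    and "\<forall>v\<in>internal_verts (lattice_graph fs bs) straight_edge.
      2 * tri_count (lattice_graph fs bs) straight_edge v
        + 3 * quad_count (lattice_graph fs bs) straight_edge v \<ge> 12"
    and "boundary_verts (lattice_graph fs bs) straight_edge = pt ` set bs"
    and "pair_wf_digraph (lattice_graph fs bs)"
proof -
  interpret polygon_subdivision "map (map pt) fs" "map pt bs"
    using sub by (rule polygon_subdivision_lattice)
  show "plane_graph G straight_edge" by (rule plane_graph_G)
  show "simple_closed_boundary G straight_edge" by (rule simple_closed_boundary_G)
  show "internal_faces G straight_edge \<subseteq> triangles G straight_edge \<union> quadrangles G straight_edge"
    using assms(2) by (intro internal_faces_triangles_quadrangles) auto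
  show bv: "boundary_verts G straight_edge = pt ` set bs"
    by (simp add: boundary_verts_G)
  interpret pair_graph G by (rule pair_graph_G)
  show "pair_wf_digraph G" by (rule pair_wf_digraph)
  show "\<forall>v\<in>internal_verts G straight_edge.
      2 * tri_count G straight_edge v + 3 * quad_count G straight_edge v \<ge> 12"
  proof
    fix v assume "v \<in> internal_verts G straight_edge"
    then have V: "v \<in> V" "v \<notin> pt ` set bs" by (auto simp: internal_verts_def bv)
    then obtain p where p: "v = pt p" "p \<in> set (concat fs)" "p \<notin> set bs"
      by (auto simp: face_verts_def)
    have mem: "pt p \<in> pt ` set f \<longleftrightarrow> p \<in> set f" for f by auto
    have "12 \<le> 2 * length (filter (\<lambda>f. length f = 3 \<and> p \<in> set f) fs)
         + 3 * length (filter (\<lambda>f. length f = 4 \<and> p \<in> set f) fs)"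
      using assms(3) p(2,3) unfolding nonpositive_curvature_def by blast
    then show "12 \<le> 2 * tri_count G straight_edge v + 3 * quad_count G straight_edge v"
      using tri_count_G[OF V(1)] quad_count_G[OF V(1)]
      by (simp add: p(1) filter_map o_def mem)
  qed
qed

lemma graph_dist_lattice_graph:
  assumes "pair_wf_digraph (lattice_graph fs bs)" "u \<in> face_verts fs"
  shows "graph_dist (lattice_graph fs bs) (pt u) (pt v)
    = (INF k\<in>{k. v \<in> set (reached (arc_list fs bs) u k)}. ereal (real k))"
  using assms
  by (simp add: graph_dist_reflcl_relpow face_verts_map face_arcs_map relpow_map_prod inj_pt
      set_reached set_arc_list)

definition same_balls :: "('a \<times> 'a) list \<Rightarrow> ('a \<times> 'a) list \<Rightarrow> 'a list \<Rightarrow> 'a \<Rightarrow> nat \<Rightarrow> bool" where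
  "same_balls es es' bs u k \<longleftrightarrow>
     (let W = reached es u k; W' = reached es' u k in \<forall>v\<in>set bs. v \<in> set W \<longleftrightarrow> v \<in> set W')"

text \<open>
  All boundary vertices are reached within \<open>d\<close> steps, so equality of the smaller balls settles all distances.
\<close>

definition same_distances :: "nat \<Rightarrow> ('a \<times> 'a) list \<Rightarrow> ('a \<times> 'a) list \<Rightarrow> 'a list \<Rightarrow> bool" where
  "same_distances d es es' bs \<longleftrightarrow> (\<forall>u\<in>set bs.
     (\<forall>k\<in>set [0..<d]. same_balls es es' bs u k) \<and>
     set bs \<subseteq> set (reached es u d) \<and> set bs \<subseteq> set (reached es' u d))"

definition dominated :: "'a list \<Rightarrow> ('a \<times> 'a) list \<Rightarrow> bool" where
  "dominated vs es \<longleftrightarrow> (\<exists>z\<in>set vs. \<exists>c\<in>set vs. z \<noteq> c \<and>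
     (\<forall>e\<in>set es. fst e = z \<longrightarrow> (c, snd e) \<in> set es))"

lemma graph_dist_eq:
  assumes same: "same_distances d (arc_list fs bs) (arc_list fs' bs) bs"
    and wf: "pair_wf_digraph (lattice_graph fs bs)" "pair_wf_digraph (lattice_graph fs' bs)"
    and "set bs \<subseteq> face_verts fs" "set bs \<subseteq> face_verts fs'"
    and uv: "u \<in> set bs" "v \<in> set bs"
  shows "graph_dist (lattice_graph fs bs) (pt u) (pt v) = graph_dist (lattice_graph fs' bs) (pt u) (pt v)"
proof -
  let ?r = "reached (arc_list fs bs) u" and ?r' = "reached (arc_list fs' bs) u"
  have balls: "\<forall>k\<in>set [0..<d]. same_balls (arc_list fs bs) (arc_list fs' bs) bs u k"
    and all: "set bs \<subseteq> set (?r d)" "set bs \<subseteq> set (?r' d)"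
    using bspec[OF same[unfolded same_distances_def] uv(1)] by simp_all
  have "v \<in> set (?r k) \<longleftrightarrow> v \<in> set (?r' k)" for k
  proof (cases "k < d")
    case True
    then have "same_balls (arc_list fs bs) (arc_list fs' bs) bs u k" using balls by simp
    then show ?thesis using uv(2) by (simp add: same_balls_def)
  next
    case False
    then have "d \<le> k" by simp
    then show ?thesis using reached_mono all uv(2) by (meson subsetD)
  qed
  moreover have "u \<in> face_verts fs" "u \<in> face_verts fs'" using assms uv(1) by blast+
  ultimately show ?thesis by (simp add: graph_dist_lattice_graph wf)
qed

lemma has_dominated_vertex_lattice_graph:
  "has_dominated_vertex (lattice_graph fs bs) \<longleftrightarrow> dominated (remdups (concat fs)) (arc_list fs bs)"
proof -
  have *: "parcs (lattice_graph fs bs) `` {pt z} = pt ` (face_arcs fs bs `` {z})" for z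
    by (force simp: face_arcs_map)
  have "parcs (lattice_graph fs bs) `` {pt z} \<subseteq> parcs (lattice_graph fs bs) `` {pt c} \<longleftrightarrow>
      (\<forall>e\<in>set (arc_list fs bs). fst e = z \<longrightarrow> (c, snd e) \<in> set (arc_list fs bs))" for z c
    unfolding * inj_image_subset_iff[OF inj_pt] set_arc_list by auto
  then show ?thesis
    by (simp add: has_dominated_vertex_def dominated_def face_verts_map face_verts_def)
qed

section \<open>The two graphs\<close>

abbreviation (input) b0 :: lattice_point where "b0 \<equiv> (3, - 2)"
abbreviation (input) b1 :: lattice_point where "b1 \<equiv> (4, 1)"
abbreviation (input) b2 :: lattice_point where "b2 \<equiv> (3, 3)"
abbreviation (input) b3 :: lattice_point where "b3 \<equiv> (1, 4)"
abbreviation (input) b4 :: lattice_point where "b4 \<equiv> (- 2, 3)"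
abbreviation (input) b5 :: lattice_point where "b5 \<equiv> (- 4, 1)"
abbreviation (input) b6 :: lattice_point where "b6 \<equiv> (- 5, - 2)"
abbreviation (input) b7 :: lattice_point where "b7 \<equiv> (0, - 3)"
abbreviation (input) b8 :: lattice_point where "b8 \<equiv> (2, - 3)"
abbreviation (input) apex :: lattice_point where "apex \<equiv> (4, 0)"
abbreviation (input) h0 :: lattice_point where "h0 \<equiv> (2, 1)"
abbreviation (input) h1 :: lattice_point where "h1 \<equiv> (- 1, 2)"
abbreviation (input) h2 :: lattice_point where "h2 \<equiv> (0, - 2)"

definition rim :: "lattice_point list" where
  "rim = [b0, apex, b1, b2, b3, b4, b5, b6, b7, b8]"

definition faces\<^sub>1 :: "lattice_point list list" where
  "faces\<^sub>1 =
    [[h0, h1, h2], [b0, apex, b1],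
     [b0, b1, h0], [b1, b2, h0], [b2, b3, h1, h0],
     [b3, b4, h1], [b4, b5, h1], [b5, b6, h2, h1],
     [b6, b7, h2], [b7, b8, h2], [b8, b0, h0, h2]]"

text \<open>
  The list \<open>faces\<^sub>1\<close> with the neighbours of \<open>h0\<close>, \<open>h1\<close>, \<open>h2\<close> advanced by one step along \<open>b0\<close>, \<dots>, \<open>b8\<close>.
  The coordinates are small integers for which the faces of both lists are strictly convex.
\<close>

definition faces\<^sub>2 :: "lattice_point list list" where
  "faces\<^sub>2 =
    [[h0, h1, h2], [b0, apex, b1],
     [b1, b2, h0], [b2, b3, h0], [b3, b4, h1, h0],
     [b4, b5, h1], [b5, b6, h1], [b6, b7, h2, h1],
     [b7, b8, h2], [b8, b0, h2], [b0, b1, h0, h2]]"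

lemma lattice_subdivision_faces1: "lattice_subdivision faces\<^sub>1 rim"
  by code_simp

lemma lattice_subdivision_faces2: "lattice_subdivision faces\<^sub>2 rim"
  by code_simp

lemma nonpositive_curvature_faces1: "nonpositive_curvature faces\<^sub>1 rim"
  and nonpositive_curvature_faces2: "nonpositive_curvature faces\<^sub>2 rim"
  by code_simp+

lemma face_lengths1: "\<forall>f\<in>set faces\<^sub>1. length f = 3 \<or> length f = 4"
  and face_lengths2: "\<forall>f\<in>set faces\<^sub>2. length f = 3 \<or> length f = 4"
  by code_simp+

lemma same_boundary_distances: "same_distances 4 (arc_list faces\<^sub>1 rim) (arc_list faces\<^sub>2 rim) rim"
  by code_simp

lemma dominated_faces1: "dominated (remdups (concat faces\<^sub>1)) (arc_list faces\<^sub>1 rim)"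
  by code_simp

lemma not_dominated_faces2: "\<not> dominated (remdups (concat faces\<^sub>2)) (arc_list faces\<^sub>2 rim)"
  by code_simp

theorem mainTheorem3:
  shows "\<exists>G\<^sub>1 \<gamma>\<^sub>1 G\<^sub>2 \<gamma>\<^sub>2.
     plane_graph G\<^sub>1 \<gamma>\<^sub>1 \<and> plane_graph G\<^sub>2 \<gamma>\<^sub>2 \<and>
     \<not> digraph_iso (with_proj G\<^sub>1) (with_proj G\<^sub>2) \<and>
     simple_closed_boundary G\<^sub>1 \<gamma>\<^sub>1 \<and> simple_closed_boundary G\<^sub>2 \<gamma>\<^sub>2 \<and>
     internal_faces G\<^sub>1 \<gamma>\<^sub>1 \<subseteq> triangles G\<^sub>1 \<gamma>\<^sub>1 \<union> quadrangles G\<^sub>1 \<gamma>\<^sub>1 \<and>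
     internal_faces G\<^sub>2 \<gamma>\<^sub>2 \<subseteq> triangles G\<^sub>2 \<gamma>\<^sub>2 \<union> quadrangles G\<^sub>2 \<gamma>\<^sub>2 \<and>
     (\<forall>v\<in>internal_verts G\<^sub>1 \<gamma>\<^sub>1. 2 * tri_count G\<^sub>1 \<gamma>\<^sub>1 v + 3 * quad_count G\<^sub>1 \<gamma>\<^sub>1 v \<ge> 12) \<and>
     (\<forall>v\<in>internal_verts G\<^sub>2 \<gamma>\<^sub>2. 2 * tri_count G\<^sub>2 \<gamma>\<^sub>2 v + 3 * quad_count G\<^sub>2 \<gamma>\<^sub>2 v \<ge> 12) \<and>
     (\<exists>\<phi>. bij_betw \<phi> (boundary_verts G\<^sub>1 \<gamma>\<^sub>1) (boundary_verts G\<^sub>2 \<gamma>\<^sub>2) \<and>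
          (\<forall>u\<in>boundary_verts G\<^sub>1 \<gamma>\<^sub>1. \<forall>v\<in>boundary_verts G\<^sub>1 \<gamma>\<^sub>1.
             graph_dist G\<^sub>1 u v = graph_dist G\<^sub>2 (\<phi> u) (\<phi> v)))"
proof -
  let ?G\<^sub>1 = "lattice_graph faces\<^sub>1 rim" and ?G\<^sub>2 = "lattice_graph faces\<^sub>2 rim"
  note P1 = lattice_graph_properties[OF lattice_subdivision_faces1 face_lengths1 nonpositive_curvature_faces1]
  note P2 = lattice_graph_properties[OF lattice_subdivision_faces2 face_lengths2 nonpositive_curvature_faces2]
  have not_iso: "\<not> digraph_iso (with_proj ?G\<^sub>1) (with_proj ?G\<^sub>2)"
    using has_dominated_vertex_iso dominated_faces1 not_dominated_faces2 has_dominated_vertex_lattice_graph by blast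
  have "set rim \<subseteq> face_verts faces\<^sub>1" "set rim \<subseteq> face_verts faces\<^sub>2"
    using lattice_subdivision_faces1 lattice_subdivision_faces2 by (simp_all add: lattice_subdivision_def face_verts_def)
  then have dist: "graph_dist ?G\<^sub>1 (pt u) (pt v) = graph_dist ?G\<^sub>2 (pt u) (pt v)"
    if "u \<in> set rim" "v \<in> set rim" for u v
    using graph_dist_eq[OF same_boundary_distances P1(6) P2(6)] that by blast
  have "bij_betw id (boundary_verts ?G\<^sub>1 straight_edge) (boundary_verts ?G\<^sub>2 straight_edge) \<and>
      (\<forall>u\<in>boundary_verts ?G\<^sub>1 straight_edge. \<forall>v\<in>boundary_verts ?G\<^sub>1 straight_edge.
        graph_dist ?G\<^sub>1 u v = graph_dist ?G\<^sub>2 (id u) (id v))"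
    unfolding P1(5) P2(5) using dist by auto
  then show ?thesis
    using P1(1-4) P2(1-4) not_iso by blast
qed

end
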